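(* For all $x,y\in\mathbb{R}^n$ and $p\in(0,1)$, $$\alpha_p(x,y)\le |\mathcal{A}_{p,1/p}(x)-\mathcal{A}_{p,1/p}(y)|.$$ Furthermore, if $|x|\le|y|$ (and $x\neq 0$), then also $$\alpha_p(x,y)\le |\mathcal{A}_{p,1/p}(x)-\mathcal{A}_{p,1/p}(y)|\le \frac{2}{3^p-1}\,|\mathcal{A}_{p,1/p}(x)-\mathcal{A}_{p,1/p}(z)|,$$ where $z=\frac{x}{|x|}\bigl(|x|+|x-y|\bigr)$.
   Context: $|\cdot|$ is the Euclidean norm on $\mathbb{R}^n$. For $p\in(0,1)$, $\alpha_p(x,y)=\bigl||x|^{p-1}x-|y|^{p-1}y\bigr|$, where $|x|^{p-1}x$ is interpreted as $0$ when $x=0$. For $a,b>0$ the map $\mathcal{A}_{a,b}$ on $\mathbb{R}^n$ is defined by $\mathcal{A}_{a,b}(x)=|x|^{a-1}x$ if $|x|<1$ (with value $0$ at $x=0$), and $\mathcal{A}_{a,b}(x)=|x|^{b-1}x$ if $|x|\ge 1$. *)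

theory Defs
  imports "HOL-Analysis.Analysis"
begin

text \<open>
  The radial power \<open>|x|\<^sup>a\<^sup>-\<^sup>1 x\<close>. At \<open>x = 0\<close> it is \<open>0\<close>, as required by the convention
  in use, because the scaled vector itself is \<open>0\<close>.
\<close>

definition radial_power :: "real \<Rightarrow> real ^ 'n \<Rightarrow> real ^ 'n" where
  "radial_power a x = (norm x powr (a - 1)) *\<^sub>R x"

definition alpha :: "real \<Rightarrow> real ^ 'n \<Rightarrow> real ^ 'n \<Rightarrow> real" where
  "alpha p x y = norm (radial_power p x - radial_power p y)"

definition radial_map :: "real \<Rightarrow> real \<Rightarrow> real ^ 'n \<Rightarrow> real ^ 'n" where
  "radial_map a b x = (if norm x < 1 then radial_power a x else radial_power b x)"

end

theory Submission
  imports Defs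
begin

text \<open>
  Put \<open>r = |x|\<close>, \<open>s = |y|\<close> with \<open>r \<le> s\<close>, and \<open>d = |x - y|\<close>; then \<open>s - r \<le> d \<le> s + r\<close>. The radial
  profile of the map \<open>\<A>\<close> with exponents \<open>p\<close> and \<open>1/p\<close> splits as
  \<open>f(t) = t\<^sup>p + e(t)\<close>, where the excess \<open>e\<close> vanishes on \<open>[0, 1)\<close> and equals
  \<open>t\<^sup>1\<^sup>/\<^sup>p - t\<^sup>p\<close> afterwards. The only fact about \<open>e\<close> that matters is that \<open>e(t)/t\<close> is
  nonnegative and nondecreasing.

  Every distance in question is of the form \<open>|\<rho> x - \<sigma> y|\<close>, and its square is
  \<open>(\<sigma> s - \<rho> r)\<^sup>2 + \<rho> \<sigma> (d\<^sup>2 - (s - r)\<^sup>2)\<close> (lemma \<open>norm_scaled_diff_square\<close>). Passing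
  from \<open>t\<^sup>p\<close> to \<open>f\<close> increases both terms, which gives the lower bound
  (\<open>alpha_le_radial_map\<close>).

  For the upper bound, \<open>z\<close> is the point of norm \<open>r + d\<close> on the ray through \<open>x\<close>, so
  \<open>|\<A> x - \<A> z| = f(r + d) - f(r)\<close>, and the triangle inequality permits the two summands of \<open>f\<close>
  to be treated separately. The excess satisfies the bound with constant \<open>1\<close>, because its ratio to
  \<open>t\<close> is nondecreasing (\<open>norm_diff_le_of_increasing_ratio\<close>); this suffices as
  \<open>1 \<le> 2/(3\<^sup>p - 1)\<close>. The pure power is where the constant is decided
  (\<open>norm_radial_power_diff_le\<close>). For fixed \<open>r\<close> and \<open>s\<close> the squared distance
  is an affine function of \<open>d\<^sup>2\<close>. The function \<open>\<phi>(t) = (r + t)\<^sup>p - r\<^sup>p\<close> is concave with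
  \<open>\<phi>(0) = 0\<close>, so on \<open>[s - r, s + r]\<close> it dominates its chord \<open>a + b t\<close> with \<open>a, b \<ge> 0\<close>, and the
  square of that chord is concave in \<open>t\<^sup>2\<close>. It is therefore enough to compare at the two ends of the
  interval, where \<open>x\<close> and \<open>y\<close> are parallel or antiparallel. The second case is
  \<open>powr_sum_le_antipodal\<close>; equality for \<open>y = - x\<close> is what produces \<open>2/(3\<^sup>p - 1)\<close>.
\<close>

section \<open>Distances between rescaled vectors\<close>

text \<open>
  The law of cosines, with the angle eliminated in favour of \<open>|x - y|\<close>. For fixed norms
  of \<open>x\<close> and \<open>y\<close> the right-hand side is affine in \<open>|x - y|\<^sup>2\<close>, and for \<open>\<rho>, \<sigma> \<ge> 0\<close> both summands
  are nonnegative.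
\<close>

lemma norm_scaled_diff_square:
  fixes x y :: "'a::real_inner"
  shows "(norm (\<rho> *\<^sub>R x - \<sigma> *\<^sub>R y))\<^sup>2 =
    (\<sigma> * norm y - \<rho> * norm x)\<^sup>2 + \<rho> * \<sigma> * ((norm (x - y))\<^sup>2 - (norm y - norm x)\<^sup>2)"
proof -
  have d: "(norm (u - v))\<^sup>2 = (norm u)\<^sup>2 + (norm v)\<^sup>2 - 2 * (u \<bullet> v)" for u v :: 'a
    by (simp add: power2_norm_eq_inner inner_diff inner_commute)
  show ?thesis
    unfolding d by (simp add: power_mult_distrib power2_diff algebra_simps)
qed

text \<open>
  For a radial profile \<open>g\<close> with \<open>g(t)/t\<close> nondecreasing, take \<open>\<rho>, \<sigma>, \<mu>\<close> to be this ratio at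
  \<open>|x|\<close>, \<open>|y|\<close> and \<open>|x| + |x - y|\<close>: the image of \<open>y\<close> is then no farther from the image of \<open>x\<close> than
  is the image of the point at distance \<open>|x - y|\<close> from \<open>x\<close> on the outward ray. After squaring,
  the gap factors explicitly.
\<close>

lemma norm_diff_le_of_increasing_ratio:
  fixes x y :: "'a::real_inner"
  assumes "0 \<le> \<rho>" "\<rho> \<le> \<sigma>" "\<sigma> \<le> \<mu>" and xy: "norm x \<le> norm y"
  shows "norm (\<rho> *\<^sub>R x - \<sigma> *\<^sub>R y) \<le> \<mu> * (norm x + norm (x - y)) - \<rho> * norm x"
proof -
  define r s d where "r = norm x" "s = norm y" "d = norm (x - y)"
  have nn: "0 \<le> r" "r \<le> s" "0 \<le> d" using xy by (auto simp: r_s_d_def)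
  have tri: "s \<le> r + d"
    unfolding r_s_d_def by (metis norm_minus_commute norm_triangle_sub)
  have "(\<sigma> * (r + d) - \<rho> * r)\<^sup>2 - ((\<sigma> * s - \<rho> * r)\<^sup>2 + \<rho> * \<sigma> * (d\<^sup>2 - (s - r)\<^sup>2))
      = \<sigma> * (r + d - s) * ((\<sigma> - \<rho>) * (r + d + s))"
    by algebra
  also have "\<dots> \<ge> 0"
    using assms nn tri by (intro mult_nonneg_nonneg) auto
  finally have "(norm (\<rho> *\<^sub>R x - \<sigma> *\<^sub>R y))\<^sup>2 \<le> (\<sigma> * (r + d) - \<rho> * r)\<^sup>2"
    by (simp add: norm_scaled_diff_square r_s_d_def)
  moreover have "\<rho> * r \<le> \<sigma> * (r + d)"
    using assms nn by (intro mult_mono) auto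
  ultimately have "norm (\<rho> *\<^sub>R x - \<sigma> *\<^sub>R y) \<le> \<sigma> * (r + d) - \<rho> * r"
    using power2_le_imp_le diff_ge_0_iff_ge by blast
  also have "\<dots> \<le> \<mu> * (r + d) - \<rho> * r"
    using assms nn by (simp add: mult_right_mono)
  finally show ?thesis by (simp add: r_s_d_def)
qed

section \<open>Reduction to collinear vectors\<close>

text \<open>
  In the variable \<open>D = d\<^sup>2\<close> the left-hand side is affine and the right-hand side, being
  \<open>a\<^sup>2 + 2 a b \<surd>D + b\<^sup>2 D\<close>, is concave, so the inequality extends from the endpoints to the interval.
  The proof writes the gap as the interpolated endpoint gaps plus the gap of \<open>\<surd>D\<close>
  above its chord.
\<close>

lemma quadratic_le_squared_line:
  fixes d :: real
  assumes d: "0 \<le> d\<^sub>0" "d\<^sub>0 \<le> d" "d \<le> d\<^sub>1" "d\<^sub>0 < d\<^sub>1" and ab: "0 \<le> a" "0 \<le> b"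
    and end0: "\<alpha> + \<beta> * d\<^sub>0\<^sup>2 \<le> (a + b * d\<^sub>0)\<^sup>2"
    and end1: "\<alpha> + \<beta> * d\<^sub>1\<^sup>2 \<le> (a + b * d\<^sub>1)\<^sup>2"
  shows "\<alpha> + \<beta> * d\<^sup>2 \<le> (a + b * d)\<^sup>2"
proof -
  have sq: "d\<^sub>0\<^sup>2 \<le> d\<^sup>2" "d\<^sup>2 \<le> d\<^sub>1\<^sup>2" "d\<^sub>0\<^sup>2 < d\<^sub>1\<^sup>2"
    using d by (auto intro: power_mono power_strict_mono)
  have "(d\<^sub>1\<^sup>2 - d\<^sub>0\<^sup>2) * ((a + b * d)\<^sup>2 - (\<alpha> + \<beta> * d\<^sup>2))
    = (d\<^sub>1\<^sup>2 - d\<^sup>2) * ((a + b * d\<^sub>0)\<^sup>2 - (\<alpha> + \<beta> * d\<^sub>0\<^sup>2))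
    + (d\<^sup>2 - d\<^sub>0\<^sup>2) * ((a + b * d\<^sub>1)\<^sup>2 - (\<alpha> + \<beta> * d\<^sub>1\<^sup>2))
    + 2 * a * b * ((d\<^sub>1 - d\<^sub>0) * (d - d\<^sub>0) * (d\<^sub>1 - d))"
    by algebra
  also have "\<dots> \<ge> 0"
    using d ab sq end0 end1 by (intro add_nonneg_nonneg mult_nonneg_nonneg) auto
  finally show ?thesis
    using sq by (simp add: zero_le_mult_iff)
qed

lemma concave_on_powr:
  assumes "0 < p" "p \<le> 1"
  shows "concave_on {0<..} (\<lambda>t::real. t powr p)"
proof (rule f''_le0_imp_concave)
  fix t :: real assume "t \<in> {0<..}"
  then show "((\<lambda>t. t powr p) has_real_derivative p * t powr (p - 1)) (at t)"
    and "((\<lambda>t. p * t powr (p - 1)) has_real_derivative p * ((p - 1) * t powr (p - 1 - 1))) (at t)"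
    by (auto intro!: derivative_eq_intros)
  show "p * ((p - 1) * t powr (p - 1 - 1)) \<le> 0"
    using assms by (simp add: mult_nonneg_nonpos mult_nonpos_nonneg)
qed auto

text \<open>
  Concavity with the denominators cleared, so that the degenerate case \<open>u = w\<close> is
  included.
\<close>

lemma powr_ge_chord:
  fixes u v w p :: real
  assumes p: "0 < p" "p < 1" and uvw: "0 < u" "u \<le> v" "v \<le> w"
  shows "(w - v) * u powr p + (v - u) * w powr p \<le> (w - u) * v powr p"
proof (cases "u = w")
  case True
  then show ?thesis using uvw by simp
next
  case False
  define t where "t = (v - u) / (w - u)"
  have v: "(1 - t) * u + t * w = v"
  proof -
    have "t * (w - u) = v - u" using False by (simp add: t_def)
    then show ?thesis by (simp add: algebra_simps)
  qed
  have t: "0 \<le> t" "t \<le> 1" using False uvw by (auto simp: t_def)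
  have "(1 - t) * u powr p + t * w powr p \<le> ((1 - t) *\<^sub>R u + t *\<^sub>R w) powr p"
    using p uvw t by (intro concave_onD[OF concave_on_powr]) auto
  then have "(w - u) * ((1 - t) * u powr p + t * w powr p) \<le> (w - u) * v powr p"
    using uvw v by (intro mult_left_mono) auto
  moreover have "(w - u) * t = v - u" "(w - u) * (1 - t) = w - v"
    using False by (auto simp: t_def field_simps)
  ultimately show ?thesis
    by (simp add: distrib_left flip: mult.assoc)
qed

section \<open>The pure power\<close>

lemma three_powr_bounds:
  fixes p :: real
  assumes "0 < p" "p < 1"
  shows "1 < 3 powr p" "3 powr p \<le> 3"
  using assms powr_mono[of p 1 "3::real"] by auto

text \<open>
  The case of antiparallel vectors of norms \<open>r\<close> and \<open>s\<close>. At \<open>s = r\<close> it is an equality, since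
  \<open>(3 r)\<^sup>p - r\<^sup>p = (3\<^sup>p - 1) r\<^sup>p\<close>. As \<open>s\<close> grows the right-hand side gains at least as fast as the
  left-hand side: for \<open>t \<ge> r\<close> one has \<open>t + 2 r \<le> 3 t\<close>, so the derivatives compare through
  \<open>1 \<le> 2 \<cdot> 3\<^sup>p\<^sup>-\<^sup>1 / (3\<^sup>p - 1)\<close>, which says that \<open>3\<^sup>p \<le> 3\<close>.
\<close>

lemma powr_sum_le_antipodal:
  fixes r s p :: real
  assumes p: "0 < p" "p < 1" and rs: "0 < r" "r \<le> s"
  shows "s powr p + r powr p \<le> 2 / (3 powr p - 1) * ((s + 2 * r) powr p - r powr p)"
proof -
  define C where "C = 2 / (3 powr p - 1)"
  have den: "0 < 3 powr p - 1" using three_powr_bounds p by simp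
  define h where "h t = C * (t + 2 * r) powr p - t powr p" for t
  have "h r \<le> h s"
  proof (rule DERIV_nonneg_imp_nondecreasing[OF rs(2)])
    fix t assume t: "r \<le> t" "t \<le> s"
    have "(h has_real_derivative p * (C * (t + 2 * r) powr (p - 1) - t powr (p - 1))) (at t)"
      unfolding h_def using t rs by (auto intro!: derivative_eq_intros simp: algebra_simps)
    moreover have "0 \<le> p * (C * (t + 2 * r) powr (p - 1) - t powr (p - 1))"
    proof -
      have "1 \<le> C * 3 powr (p - 1)"
        using den p three_powr_bounds[OF p] by (simp add: C_def powr_diff field_simps)
      then have "1 * t powr (p - 1) \<le> C * 3 powr (p - 1) * t powr (p - 1)"
        by (intro mult_right_mono) auto
      also have "\<dots> = C * (3 * t) powr (p - 1)"
        using t rs by (simp add: powr_mult)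
      also have "\<dots> \<le> C * (t + 2 * r) powr (p - 1)"
        using den t rs p by (intro mult_left_mono powr_mono2') (auto simp: C_def less_imp_le)
      finally show ?thesis using p by simp
    qed
    ultimately show "\<exists>y. (h has_real_derivative y) (at t) \<and> 0 \<le> y" by blast
  qed
  moreover have "h r = (C + 1) * r powr p"
  proof -
    have "(r + 2 * r) powr p = 3 powr p * r powr p"
      using rs by (simp flip: powr_mult)
    then have "h r = C * 3 powr p * r powr p - r powr p"
      by (simp only: h_def mult.assoc)
    moreover have "C * (3 powr p - 1) = 2"
      using nonzero_eq_divide_eq[of "3 powr p - 1" C 2] den C_def by linarith
    then have "C * 3 powr p = C + 2"
      by (simp add: algebra_simps)
    ultimately show ?thesis
      by (simp only:) (simp add: algebra_simps)
  qed
  ultimately show ?thesis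
    by (simp add: h_def C_def[symmetric] algebra_simps)
qed

text \<open>
  Both sides are functions of \<open>d = |x - y|\<close> once \<open>r = |x|\<close> and \<open>s = |y|\<close> are fixed. Replacing the
  concave right-hand side by its chord over \<open>[s - r, s + r]\<close> brings the claim into the form of
  \<open>quadratic_le_squared_line\<close>, which leaves the two endpoints. At \<open>d = s - r\<close> the two
  sides differ only by the constant factor, and at \<open>d = s + r\<close> the left-hand side is
  \<open>s\<^sup>p + r\<^sup>p\<close>.
\<close>

lemma norm_radial_power_diff_le:
  fixes x y :: "real ^ 'n"
  assumes p: "0 < p" "p < 1" and x: "x \<noteq> 0" and xy: "norm x \<le> norm y"
  shows "norm (radial_power p x - radial_power p y)
    \<le> 2 / (3 powr p - 1) * ((norm x + norm (x - y)) powr p - norm x powr p)"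
proof -
  define C where "C = 2 / (3 powr p - 1)"
  have C: "1 \<le> C" using three_powr_bounds[OF p] by (simp add: C_def)
  define r s d where "r = norm x" "s = norm y" "d = norm (x - y)"
  have rs: "0 < r" "r \<le> s" using x xy by (auto simp: r_s_d_def)
  have d: "s - r \<le> d" "d \<le> s + r"
    unfolding r_s_d_def using norm_triangle_ineq2[of y x] norm_triangle_ineq4[of x y]
    by (auto simp: norm_minus_commute)
  define \<phi> where "\<phi> t = (r + t) powr p - r powr p" for t
  define b where "b = (\<phi> (s + r) - \<phi> (s - r)) / (2 * r)"
  define a where "a = \<phi> (s - r) - b * (s - r)"
  have b: "0 \<le> b"
    using rs p by (auto simp: b_def \<phi>_def intro!: divide_nonneg_pos powr_mono2)
  \<comment> \<open>The chord of a concave function vanishing at the origin has nonnegative intercept: this is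
    concavity of the power at \<open>r \<le> s \<le> s + 2 r\<close>.\<close>
  have a: "0 \<le> a"
  proof -
    have "(s - r) * \<phi> (s + r) \<le> (s + r) * \<phi> (s - r)"
      using powr_ge_chord[OF p, of r s "s + 2 * r"] rs
      by (simp add: \<phi>_def algebra_simps)
    then show ?thesis using rs by (simp add: a_def b_def field_simps)
  qed
  have a0: "a + b * (s - r) = \<phi> (s - r)" by (simp add: a_def)
  have a1: "a + b * (s + r) = \<phi> (s + r)"
    using rs by (simp add: a_def b_def field_simps)
  have chord: "a + b * d \<le> \<phi> d"
  proof -
    have "(s + r - d) * \<phi> (s - r) + (d - (s - r)) * \<phi> (s + r) \<le> 2 * r * \<phi> d"
      using powr_ge_chord[OF p, of s "r + d" "s + 2 * r"] rs d
      by (simp add: \<phi>_def algebra_simps)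
    moreover have "b * (2 * r) = \<phi> (s + r) - \<phi> (s - r)" using rs by (simp add: b_def)
    moreover have "2 * r * (a + b * d) = 2 * r * \<phi> (s - r) + b * (2 * r) * (d - (s - r))"
      by (simp add: a_def algebra_simps)
    ultimately have "2 * r * (a + b * d) \<le> 2 * r * \<phi> d"
      by (simp only:) (simp add: algebra_simps)
    then show ?thesis using rs by simp
  qed
  define \<rho> \<sigma> where "\<rho> = r powr (p - 1)" "\<sigma> = s powr (p - 1)"
  have pow: "\<rho> * r = r powr p" "\<sigma> * s = s powr p"
    using rs by (auto simp: \<rho>_\<sigma>_def powr_diff)
  define \<alpha> where "\<alpha> = (s powr p - r powr p)\<^sup>2 - \<rho> * \<sigma> * (s - r)\<^sup>2"
  have nsq: "(norm (radial_power p x - radial_power p y))\<^sup>2 = \<alpha> + \<rho> * \<sigma> * d\<^sup>2"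
    using norm_scaled_diff_square[of \<rho> x \<sigma> y] pow
    by (simp add: radial_power_def \<rho>_\<sigma>_def r_s_d_def \<alpha>_def algebra_simps)
  have "\<alpha> + \<rho> * \<sigma> * d\<^sup>2 \<le> (C * a + C * b * d)\<^sup>2"
  proof (rule quadratic_le_squared_line[where d\<^sub>0 = "s - r" and d\<^sub>1 = "s + r"])
    have "r powr p \<le> s powr p" using rs p by (intro powr_mono2) auto
    then have "s powr p - r powr p \<le> C * \<phi> (s - r)"
      using mult_right_mono[OF C, of "s powr p - r powr p"] by (simp add: \<phi>_def)
    then have "(s powr p - r powr p)\<^sup>2 \<le> (C * \<phi> (s - r))\<^sup>2"
      using \<open>r powr p \<le> s powr p\<close> by (intro power_mono) auto
    then show "\<alpha> + \<rho> * \<sigma> * (s - r)\<^sup>2 \<le> (C * a + C * b * (s - r))\<^sup>2"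
      by (simp add: \<alpha>_def mult.assoc a0 flip: distrib_left)
    have "\<alpha> + \<rho> * \<sigma> * (s + r)\<^sup>2 = (s powr p - r powr p)\<^sup>2 + 4 * (\<rho> * r) * (\<sigma> * s)"
      unfolding \<alpha>_def by algebra
    also have "\<dots> = (s powr p + r powr p)\<^sup>2"
      unfolding pow by algebra
    also have "\<dots> \<le> (C * \<phi> (s + r))\<^sup>2"
      using powr_sum_le_antipodal[OF p rs]
      by (intro power_mono) (auto simp: C_def \<phi>_def algebra_simps)
    finally show "\<alpha> + \<rho> * \<sigma> * (s + r)\<^sup>2 \<le> (C * a + C * b * (s + r))\<^sup>2"
      by (simp add: mult.assoc a1 flip: distrib_left)
    show "0 \<le> C * a" "0 \<le> C * b"
      using a b C by (simp_all only: mult_nonneg_nonneg order_trans[OF zero_le_one C])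
  qed (use rs d in linarith)+
  also have "C * a + C * b * d = C * (a + b * d)"
    by (simp only: distrib_left mult.assoc)
  finally have "(norm (radial_power p x - radial_power p y))\<^sup>2 \<le> (C * (a + b * d))\<^sup>2"
    by (simp only: nsq)
  then have "norm (radial_power p x - radial_power p y) \<le> C * (a + b * d)"
  proof (rule power2_le_imp_le)
    have "0 \<le> d" using rs d by linarith
    then show "0 \<le> C * (a + b * d)"
      using a b C by (intro mult_nonneg_nonneg add_nonneg_nonneg) linarith+
  qed
  also have "\<dots> \<le> C * \<phi> d" using chord C by (intro mult_left_mono) auto
  finally show ?thesis by (simp only: C_def \<phi>_def r_s_d_def)
qed

section \<open>The excess over the pure power\<close>

text \<open>
  With \<open>f\<close> the radial profile of the map with exponents \<open>p\<close> and \<open>1/p\<close>, this is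
  \<open>(f(t) - t\<^sup>p)/t\<close>. The ratio is used instead of the difference because it is the scalar that
  multiplies the vector, and because its monotonicity is stronger than that of the difference.
\<close>

definition excess_ratio :: "real \<Rightarrow> real \<Rightarrow> real" where
  "excess_ratio p t = (if t < 1 then 0 else t powr (1 / p - 1) - t powr (p - 1))"

lemma radial_map_eq:
  "radial_map p (1 / p) x = (norm x powr (p - 1) + excess_ratio p (norm x)) *\<^sub>R x"
  by (simp add: radial_map_def radial_power_def excess_ratio_def)

lemma excess_ratio_nonneg:
  assumes "0 < p" "p < 1"
  shows "0 \<le> excess_ratio p t"
proof -
  have "p \<le> 1 / p"
    using assms mult_mono[of p 1 p 1] by (simp add: field_simps)
  then show ?thesis by (auto simp: excess_ratio_def intro: powr_mono)
qed

lemma excess_ratio_mono: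
  assumes p: "0 < p" "p < 1" and "t \<le> u"
  shows "excess_ratio p t \<le> excess_ratio p u"
proof (cases "t < 1")
  case True
  then show ?thesis using excess_ratio_nonneg[OF p, of u] by (simp add: excess_ratio_def)
next
  case False
  then have "t powr (1 / p - 1) \<le> u powr (1 / p - 1)"
    using assms by (intro powr_mono2) auto
  moreover have "u powr (p - 1) \<le> t powr (p - 1)"
    using False assms by (intro powr_mono2') auto
  ultimately show ?thesis using False assms by (simp add: excess_ratio_def)
qed

section \<open>The two inequalities\<close>

text \<open>
  Adding the excess enlarges the gap between the norms of the two images, as well as the product
  of the scaling factors, and these are the only two quantities through which the distance in
  \<open>norm_scaled_diff_square\<close> depends on the radial profile.
\<close>

lemma alpha_le_radial_map:
  fixes x y :: "real ^ 'n"
  assumes p: "0 < p" "p < 1" and xy: "norm x \<le> norm y"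
  shows "alpha p x y \<le> norm (radial_map p (1 / p) x - radial_map p (1 / p) y)"
proof -
  define r s where "r = norm x" "s = norm y"
  define \<rho> \<sigma> where "\<rho> = r powr (p - 1)" "\<sigma> = s powr (p - 1)"
  define e f where "e = excess_ratio p r" "f = excess_ratio p s"
  have nn: "0 \<le> \<rho>" "0 \<le> \<sigma>" "0 \<le> r" "r \<le> s"
    using xy by (auto simp: \<rho>_\<sigma>_def r_s_def)
  have ef: "0 \<le> e" "e \<le> f"
    using excess_ratio_nonneg[OF p] excess_ratio_mono[OF p nn(4)] by (auto simp: e_f_def)
  have pow: "t powr (p - 1) * t = t powr p" if "0 \<le> t" for t
    using that by (cases "t = 0") (auto simp: powr_diff)
  have \<rho>\<sigma>: "\<rho> * r \<le> \<sigma> * s"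
    using nn p by (auto simp: \<rho>_\<sigma>_def pow intro: powr_mono2)
  have "e * r \<le> f * s" using nn ef by (intro mult_mono) auto
  then have "(\<sigma> * s - \<rho> * r)\<^sup>2 \<le> ((\<sigma> + f) * s - (\<rho> + e) * r)\<^sup>2"
    using \<rho>\<sigma> by (intro power_mono) (auto simp: algebra_simps)
  moreover have "(s - r)\<^sup>2 \<le> (norm (x - y))\<^sup>2"
    using nn norm_triangle_ineq2[of y x]
    by (intro power_mono) (auto simp: r_s_def norm_minus_commute)
  then have "\<rho> * \<sigma> * ((norm (x - y))\<^sup>2 - (s - r)\<^sup>2)
      \<le> (\<rho> + e) * (\<sigma> + f) * ((norm (x - y))\<^sup>2 - (s - r)\<^sup>2)"
    using nn ef by (intro mult_right_mono mult_mono) auto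
  ultimately have "(norm (\<rho> *\<^sub>R x - \<sigma> *\<^sub>R y))\<^sup>2
      \<le> (norm ((\<rho> + e) *\<^sub>R x - (\<sigma> + f) *\<^sub>R y))\<^sup>2"
    by (simp only: norm_scaled_diff_square flip: r_s_def)
  then show ?thesis
    by (simp add: alpha_def radial_power_def radial_map_eq \<rho>_\<sigma>_def e_f_def r_s_def)
qed

text \<open>
  The bound for the pure power and the bound for the excess add up, because \<open>x\<close> and \<open>z\<close>
  lie on one ray, where the contributions of the two nondecreasing profiles to the distance add
  exactly.
\<close>

lemma radial_map_diff_le:
  fixes x y :: "real ^ 'n"
  assumes p: "0 < p" "p < 1" and x: "x \<noteq> 0" and xy: "norm x \<le> norm y"
  defines "z \<equiv> ((norm x + norm (x - y)) / norm x) *\<^sub>R x"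
  shows "norm (radial_map p (1 / p) x - radial_map p (1 / p) y)
    \<le> 2 / (3 powr p - 1) * norm (radial_map p (1 / p) x - radial_map p (1 / p) z)"
proof -
  define C where "C = 2 / (3 powr p - 1)"
  have C: "1 \<le> C" using three_powr_bounds[OF p] by (simp add: C_def)
  define r m where "r = norm x" "m = norm x + norm (x - y)"
  have rm: "0 < r" "r \<le> m" using x by (auto simp: r_m_def)
  have ym: "norm y \<le> m"
    unfolding r_m_def by (metis norm_minus_commute norm_triangle_sub)
  \<comment> \<open>the excess \<open>f(t) - t\<^sup>p\<close> itself\<close>
  define E where "E t = excess_ratio p t * t" for t
  have E: "E r \<le> E m"
    unfolding E_def using rm excess_ratio_mono[OF p rm(2)] excess_ratio_nonneg[OF p]
    by (intro mult_mono) auto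
  have pow: "t powr (p - 1) * t = t powr p" if "0 < t" for t
    using that by (auto simp: powr_diff)
  have z_eq: "z = (m / r) *\<^sub>R x" by (simp add: z_def r_m_def)
  then have "norm z = m" using rm by (simp flip: r_m_def(1))
  then have "radial_map p (1 / p) z = ((m powr (p - 1) + excess_ratio p m) * (m / r)) *\<^sub>R x"
    by (simp add: radial_map_eq) (simp add: z_eq)
  then have "radial_map p (1 / p) x - radial_map p (1 / p) z
      = ((r powr (p - 1) + excess_ratio p r)
          - (m powr (p - 1) + excess_ratio p m) * (m / r)) *\<^sub>R x"
    by (simp add: radial_map_eq scaleR_left_diff_distrib flip: r_m_def(1))
  then have "norm (radial_map p (1 / p) x - radial_map p (1 / p) z)
      = \<bar>((r powr (p - 1) + excess_ratio p r)
          - (m powr (p - 1) + excess_ratio p m) * (m / r)) * r\<bar>"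
    using rm by (simp add: abs_mult flip: r_m_def(1))
  also have "\<dots> = \<bar>(r powr p + E r) - (m powr p + E m)\<bar>"
    using rm pow[of r] pow[of m] by (simp add: E_def algebra_simps)
  also have "\<dots> = (m powr p - r powr p) + (E m - E r)"
    using E rm p powr_mono2[of p r m] by simp
  finally have z: "norm (radial_map p (1 / p) x - radial_map p (1 / p) z)
      = (m powr p - r powr p) + (E m - E r)" .
  have "radial_map p (1 / p) x - radial_map p (1 / p) y
      = (radial_power p x - radial_power p y)
        + (excess_ratio p (norm x) *\<^sub>R x - excess_ratio p (norm y) *\<^sub>R y)"
    by (simp add: radial_map_eq radial_power_def algebra_simps)
  then have "norm (radial_map p (1 / p) x - radial_map p (1 / p) y)
      \<le> norm (radial_power p x - radial_power p y)
        + norm (excess_ratio p (norm x) *\<^sub>R x - excess_ratio p (norm y) *\<^sub>R y)"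
    by (simp only: norm_triangle_ineq)
  moreover have "norm (radial_power p x - radial_power p y) \<le> C * (m powr p - r powr p)"
    using norm_radial_power_diff_le[OF p x xy] by (simp add: C_def r_m_def)
  moreover have "norm (excess_ratio p (norm x) *\<^sub>R x - excess_ratio p (norm y) *\<^sub>R y) \<le> E m - E r"
    using norm_diff_le_of_increasing_ratio[OF excess_ratio_nonneg[OF p]
        excess_ratio_mono[OF p xy] excess_ratio_mono[OF p ym] xy]
    by (simp add: E_def r_m_def)
  moreover have "E m - E r \<le> C * (E m - E r)"
    using mult_right_mono[OF C, of "E m - E r"] E by simp
  ultimately have "norm (radial_map p (1 / p) x - radial_map p (1 / p) y)
      \<le> C * (m powr p - r powr p) + C * (E m - E r)"
    by linarith
  then show ?thesis
    by (simp only: z C_def distrib_left)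
qed

theorem theorem1p7:
  fixes x y :: "real ^ 'n" and p :: real
  assumes "0 < p" and "p < 1"
  shows "alpha p x y \<le> norm (radial_map p (1 / p) x - radial_map p (1 / p) y) \<and>
    (norm x \<le> norm y \<and> x \<noteq> 0 \<longrightarrow>
      (let z = ((norm x + norm (x - y)) / norm x) *\<^sub>R x in
        alpha p x y \<le> norm (radial_map p (1 / p) x - radial_map p (1 / p) y) \<and>
        norm (radial_map p (1 / p) x - radial_map p (1 / p) y)
          \<le> 2 / (3 powr p - 1) * norm (radial_map p (1 / p) x - radial_map p (1 / p) z)))"
proof -
  have "alpha p x y \<le> norm (radial_map p (1 / p) x - radial_map p (1 / p) y)"
  proof (cases "norm x \<le> norm y")
    case True
    then show ?thesis using alpha_le_radial_map assms by blast
  next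
    case False
    then show ?thesis
      using alpha_le_radial_map[of p y x] assms by (simp add: alpha_def norm_minus_commute)
  qed
  moreover have "norm (radial_map p (1 / p) x - radial_map p (1 / p) y)
      \<le> 2 / (3 powr p - 1) * norm (radial_map p (1 / p) x
          - radial_map p (1 / p) (((norm x + norm (x - y)) / norm x) *\<^sub>R x))"
    if "norm x \<le> norm y \<and> x \<noteq> 0"
    using radial_map_diff_le[OF assms] that by blast
  ultimately show ?thesis
    unfolding Let_def by iprover
qed

end
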